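(* Let $V\subset\mathbb{R}^2$ be a bounded domain, $\Gamma\subset\mathbb{R}^2\setminus\overline{V}$ a compact rectifiable curve, $k>0$, $\gamma>0$, $J\ge 1$, and let $\mathcal{K}$ be the forward operator ($\boldsymbol\phi\mapsto\mathcal{K}(\boldsymbol\phi)\in L^2(\Gamma)$, $\boldsymbol\phi\in\mathbb{R}^N$) associated with either the point-source model ($N=5J$) or the extended-source model ($N=4J$), as defined in the context. Let $\mu_0$ be a Borel probability measure on $\mathbb{R}^N$ (in the point-source model, concentrated on the set of $\boldsymbol\phi$ all of whose source locations $z_j$ lie in $V$). For a bounded measurable function $Y:\Gamma\to\mathbb{C}$ put $$G(\boldsymbol\phi;Y)=\frac{1}{2\gamma^2}\|Y-\mathcal{K}(\boldsymbol\phi)\|_{L^2(\Gamma)}^2,\qquad L(Y)=\int_{\mathbb{R}^N}\exp(-G(\boldsymbol\phi;Y))\,d\mu_0(\boldsymbol\phi),$$ and let $\mu^Y$ be the measure on $\mathbb{R}^N$ given by $$\frac{d\mu^Y}{d\mu_0}(\boldsymbol\phi)=\frac{1}{L(Y)}\exp(-G(\boldsymbol\phi;Y)).$$ Then the Bayesian inverse problem of determining $\mu^Y$ from $Y$ is well-posed in both the Hellinger and the total variation metrics, in the following sense: for every $r>0$ there exists a constant $M=M(r)>0$ such that for all bounded measurable $Y,Y':\Gamma\to\mathbb{C}$ with $\max\{\|Y\|_\infty,\|Y'\|_\infty\}<r$, such that $\mu^Y$ and $\mu^{Y'}$ are both absolutely continuous with respect to $\mu_0$, $$d_H(\mu^{Y},\mu^{Y'})\le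 M\|Y-Y'\|_\infty\qquad\text{and}\qquad d_{TV}(\mu^{Y},\mu^{Y'})\le M\|Y-Y'\|_\infty .$$
   Context: Fundamental solution: $\Phi_k(x,y)=\frac{i}{4}H_0^{(1)}(k|x-y|)$ for $x\ne y$ in $\mathbb{R}^2$, where $H_0^{(1)}$ is the Hankel function of the first kind of order zero. Parameters: $\boldsymbol\phi=(\lambda_1,\dots,\lambda_J,\xi_1,\dots,\xi_J,z_1,\dots,z_J)$, with $\lambda_j\in\mathbb{R}$ and source locations $z_j\in\mathbb{R}^2$. The source is $F(\cdot;\boldsymbol\phi)=\sum_{j=1}^J F_j$, with one of the following two models. (1) Point sources: $\xi_j\in\mathbb{R}^2$ and $F_j(x)=(\lambda_j+\xi_j\cdot\nabla)\delta(x-z_j)$, where $\delta$ is the Dirac distribution; here $N=5J$, and the support of $F$ is assumed to lie in $V$, i.e. $z_j\in V$ for all $j$. (In this model each source is intended to be either a monopole or a dipole, i.e. $|\lambda_j|+|\xi_j|\ne0$ and $|\lambda_j\xi_j|=0$, but the formula for $\mathcal{K}$ makes sense without this restriction.) (2) Extended sources: $\xi_j\in\mathbb{R}$ and $F_j(x)=\lambda_j\exp(-\xi_j|x-z_j|^2)$; here $N=4J$. Forward operator: for $y\in\Gamma$, $\mathcal{K}(\boldsymbol\phi)(y)=\int_V\Phi_k(y,x)F(x;\boldsymbol\phi)\,dx$. In model (1) the integral is understood in the distributional sense, i.e. $\mathcal{K}(\boldsymbol\phi)(y)=\sum_{j=1}^J\big(\lambda_j\Phi_k(y,z_j)-\xi_j\cdot\nabla_x\Phi_k(y,x)|_{x=z_j}\big)$.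 Norms: $L^2(\Gamma)$ is taken with respect to arc length, for complex-valued functions; $\|\cdot\|_\infty$ is the supremum norm on $\Gamma$. Metrics: if probability measures $\mu_1,\mu_2$ are both absolutely continuous with respect to a measure $\mu$, then $$d_H(\mu_1,\mu_2)=\left(\frac12\int\left(\sqrt{d\mu_1/d\mu}-\sqrt{d\mu_2/d\mu}\right)^2d\mu\right)^{1/2},\qquad d_{TV}(\mu_1,\mu_2)=\frac12\int\left|d\mu_1/d\mu-d\mu_2/d\mu\right|d\mu ;$$ these do not depend on the choice of $\mu$. The constant $M$ may depend on $r$, $\gamma$, $k$, $\Gamma$, $V$, $J$ and $\mu_0$, but not on $Y,Y'$. *)

theory Defs
  imports "HOL-Probability.Probability"
begin

section \<open>The fundamental solution\<close>

definition bessel_J0 :: "real \<Rightarrow> real" where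
  "bessel_J0 x = (\<Sum>m. (-1) ^ m / (fact m)\<^sup>2 * (x / 2) ^ (2 * m))"

text \<open>The standard logarithmic series of the Bessel function of the second kind of order zero,
  for \<open>x > 0\<close>; here \<open>harm m = 1 + 1/2 + ... + 1/m\<close>.\<close>

definition bessel_Y0 :: "real \<Rightarrow> real" where
  "bessel_Y0 x = 2 / pi * ((ln (x / 2) + euler_mascheroni) * bessel_J0 x
     + (\<Sum>m. (-1) ^ (m + 1) * harm m / (fact m)\<^sup>2 * (x / 2) ^ (2 * m)))"

definition hankel1_0 :: "real \<Rightarrow> complex" where
  "hankel1_0 x = Complex (bessel_J0 x) (bessel_Y0 x)"

text \<open>Only the values for \<open>x \<noteq> y\<close> are meaningful.\<close>

definition Phi :: "real \<Rightarrow> real^2 \<Rightarrow> real^2 \<Rightarrow> complex" where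
  "Phi k x y = \<i> / 4 * hankel1_0 (k * norm (x - y))"


section \<open>Arc length on a rectifiable path\<close>

text \<open>Lengths of the polygons inscribed in \<open>g\<close> restricted to \<open>{a..b}\<close>; the vertices
  are \<open>g (s 0), ..., g (s n)\<close>.\<close>

definition inscribed_lengths :: "(real \<Rightarrow> 'a::metric_space) \<Rightarrow> real \<Rightarrow> real \<Rightarrow> real set" where
  "inscribed_lengths g a b =
     {\<Sum>i<n. dist (g (s i)) (g (s (Suc i))) | (s :: nat \<Rightarrow> real) (n :: nat). mono s \<and> range s \<subseteq> {a..b}}"

definition rectifiable_path :: "(real \<Rightarrow> 'a::metric_space) \<Rightarrow> bool" where
  "rectifiable_path g \<longleftrightarrow> path g \<and> bdd_above (inscribed_lengths g 0 1)"

text \<open>The length of \<open>g\<close> on \<open>{0..t}\<close>, extended constantly outside the unit interval. It is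
  nondecreasing and continuous in \<open>t\<close> if \<open>g\<close> is a rectifiable path, so that it
  determines a Stieltjes measure.\<close>

definition length_upto :: "(real \<Rightarrow> 'a::metric_space) \<Rightarrow> real \<Rightarrow> real" where
  "length_upto g t = Sup (inscribed_lengths g 0 (min 1 (max 0 t)))"

text \<open>Arc length as a measure on the curve \<open>path_image g\<close>: the push-forward under \<open>g\<close> of the
  Stieltjes measure of the length function, i.e. \<open>f\<close> has integral \<open>\<integral> f (g t) d(length_upto g t)\<close>.
  For simple \<open>g\<close> this depends only on the set \<open>path_image g\<close>; arcs that are traversed repeatedly
  count with multiplicity. The completion makes all subsets of null sets measurable.\<close>

definition arc_length :: "(real \<Rightarrow> 'a::metric_space) \<Rightarrow> 'a measure" where
  "arc_length g = completion
     (distr (restrict_space (interval_measure (length_upto g)) {0..1})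
            (restrict_space borel (path_image g)) g)"

definition L2_norm_on :: "'a measure \<Rightarrow> ('a \<Rightarrow> complex) \<Rightarrow> real" where
  "L2_norm_on M f = sqrt (\<integral>y. (cmod (f y))\<^sup>2 \<partial>M)"

definition sup_norm_on :: "'a set \<Rightarrow> ('a \<Rightarrow> complex) \<Rightarrow> real" where
  "sup_norm_on S f = (SUP y\<in>S. cmod (f y))"


section \<open>Source models and forward operators\<close>

text \<open>The sources are indexed by a finite type \<open>'j\<close>, so \<open>J = CARD('j)\<close>. Parameters are triples
  \<open>(\<lambda>, \<xi>, z)\<close>, i.e. vectors in \<open>\<real>\<^sup>N\<close> with \<open>N = 5 J\<close> and \<open>N = 4 J\<close>, respectively.\<close>

type_synonym 'j point_params = "(real^'j) \<times> ((real^2)^'j) \<times> ((real^2)^'j)"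
type_synonym 'j ext_params = "(real^'j) \<times> (real^'j) \<times> ((real^2)^'j)"

lemma DIM_point_params: "DIM('j::finite point_params) = 5 * CARD('j)"
  by simp

lemma DIM_ext_params: "DIM('j::finite ext_params) = 4 * CARD('j)"
  by simp

definition grad :: "(real^2 \<Rightarrow> complex) \<Rightarrow> real^2 \<Rightarrow> complex^2" where
  "grad f z = (\<chi> i. frechet_derivative f (at z) (axis i 1))"

text \<open>The distributional integral of \<open>\<Phi>\<^sub>k(y, x)\<close> against \<open>(\<lambda>\<^sub>j + \<xi>\<^sub>j \<cdot> \<nabla>) \<delta>(x - z\<^sub>j)\<close>,
  summed over \<open>j\<close>; integration by parts gives the minus sign.\<close>

definition K_point :: "real \<Rightarrow> 'j::finite point_params \<Rightarrow> real^2 \<Rightarrow> complex" where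
  "K_point k = (\<lambda>(lam, xi, z) y. \<Sum>j\<in>UNIV.
     of_real (lam $ j) * Phi k y (z $ j)
     - (\<Sum>i\<in>UNIV. of_real (xi $ j $ i) * grad (\<lambda>x. Phi k y x) (z $ j) $ i))"

definition F_ext :: "'j::finite ext_params \<Rightarrow> real^2 \<Rightarrow> real" where
  "F_ext = (\<lambda>(lam, xi, z) x. \<Sum>j\<in>UNIV. lam $ j * exp (- (xi $ j) * (norm (x - z $ j))\<^sup>2))"

definition K_ext :: "(real^2) set \<Rightarrow> real \<Rightarrow> 'j::finite ext_params \<Rightarrow> real^2 \<Rightarrow> complex" where
  "K_ext V k p y = (LINT x:V|lborel. Phi k y x * of_real (F_ext p x))"


section \<open>The posterior measure\<close>

definition misfit ::
  "(real \<Rightarrow> real^2) \<Rightarrow> ('p \<Rightarrow> real^2 \<Rightarrow> complex) \<Rightarrow> real \<Rightarrow> (real^2 \<Rightarrow> complex) \<Rightarrow> 'p \<Rightarrow> real" where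
  "misfit g K \<gamma> Y p = 1 / (2 * \<gamma>\<^sup>2) * (L2_norm_on (arc_length g) (\<lambda>y. Y y - K p y))\<^sup>2"

definition evidence ::
  "'p measure \<Rightarrow> (real \<Rightarrow> real^2) \<Rightarrow> ('p \<Rightarrow> real^2 \<Rightarrow> complex) \<Rightarrow> real \<Rightarrow> (real^2 \<Rightarrow> complex) \<Rightarrow> real" where
  "evidence \<mu>0 g K \<gamma> Y = (\<integral>p. exp (- misfit g K \<gamma> Y p) \<partial>\<mu>0)"

definition posterior ::
  "'p measure \<Rightarrow> (real \<Rightarrow> real^2) \<Rightarrow> ('p \<Rightarrow> real^2 \<Rightarrow> complex) \<Rightarrow> real \<Rightarrow> (real^2 \<Rightarrow> complex) \<Rightarrow> 'p measure" where
  "posterior \<mu>0 g K \<gamma> Y =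
     density \<mu>0 (\<lambda>p. ennreal (1 / evidence \<mu>0 g K \<gamma> Y * exp (- misfit g K \<gamma> Y p)))"


section \<open>Metrics on probability measures and well-posedness\<close>

text \<open>The first argument \<open>\<mu>\<close> is the dominating reference measure, on whose choice the values
  do not depend as long as \<open>\<mu>1\<close> and \<open>\<mu>2\<close> are absolutely continuous with respect to \<open>\<mu>\<close>.\<close>

definition hellinger_dist :: "'p measure \<Rightarrow> 'p measure \<Rightarrow> 'p measure \<Rightarrow> real" where
  "hellinger_dist \<mu> \<mu>1 \<mu>2 =
     sqrt (1 / 2 * (\<integral>p. (sqrt (enn2real (RN_deriv \<mu> \<mu>1 p)) - sqrt (enn2real (RN_deriv \<mu> \<mu>2 p)))\<^sup>2 \<partial>\<mu>))"

definition tv_dist :: "'p measure \<Rightarrow> 'p measure \<Rightarrow> 'p measure \<Rightarrow> real" where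
  "tv_dist \<mu> \<mu>1 \<mu>2 =
     1 / 2 * (\<integral>p. \<bar>enn2real (RN_deriv \<mu> \<mu>1 p) - enn2real (RN_deriv \<mu> \<mu>2 p)\<bar> \<partial>\<mu>)"

definition bounded_measurable_data :: "(real \<Rightarrow> real^2) \<Rightarrow> (real^2 \<Rightarrow> complex) \<Rightarrow> bool" where
  "bounded_measurable_data g Y \<longleftrightarrow> Y \<in> borel_measurable (arc_length g) \<and> bounded (Y ` path_image g)"

definition bayes_well_posed ::
  "'p measure \<Rightarrow> (real \<Rightarrow> real^2) \<Rightarrow> ('p \<Rightarrow> real^2 \<Rightarrow> complex) \<Rightarrow> real \<Rightarrow> bool" where
  "bayes_well_posed \<mu>0 g K \<gamma> \<longleftrightarrow>
     (\<forall>r>0. \<exists>M>0. \<forall>Y Y'.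
        bounded_measurable_data g Y \<and> bounded_measurable_data g Y' \<and>
        max (sup_norm_on (path_image g) Y) (sup_norm_on (path_image g) Y') < r \<and>
        absolutely_continuous \<mu>0 (posterior \<mu>0 g K \<gamma> Y) \<and>
        absolutely_continuous \<mu>0 (posterior \<mu>0 g K \<gamma> Y') \<longrightarrow>
        hellinger_dist \<mu>0 (posterior \<mu>0 g K \<gamma> Y) (posterior \<mu>0 g K \<gamma> Y')
          \<le> M * sup_norm_on (path_image g) (\<lambda>y. Y y - Y' y) \<and>
        tv_dist \<mu>0 (posterior \<mu>0 g K \<gamma> Y) (posterior \<mu>0 g K \<gamma> Y')
          \<le> M * sup_norm_on (path_image g) (\<lambda>y. Y y - Y' y))"

end

theory Submission
  imports Defs
begin

text \<open>The negative log-likelihood is \<open>c A\<^sup>2\<close> with \<open>A = \<parallel>Y - K p\<parallel>\<close>, and \<open>t \<mapsto> exp (- c t\<^sup>2)\<close> is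
  globally Lipschitz, while \<open>A\<close> is \<open>1\<close>-Lipschitz in \<open>Y\<close>. Hence the square root of the unnormalised
  posterior density depends on \<open>Y\<close> in a Lipschitz way, uniformly in the parameter \<open>p\<close>, without any
  moment condition on the prior. The evidence is bounded below on bounded sets of data because
  \<open>A \<le> r m + \<parallel>K p\<parallel>\<close>, where \<open>m\<^sup>2\<close> is the length of the curve. So the normalised square roots are
  uniformly Lipschitz in \<open>Y\<close>, which gives both estimates. Of the forward operators, only joint
  Borel measurability is used.\<close>

section \<open>Finiteness of arc length\<close>

text \<open>Holds for every \<open>F\<close>: if no measure extends the prescribed values \<open>F b - F a\<close>, then
  \<open>extend_measure\<close> falls back to the null measure. This spares the continuity of the length function.\<close>

lemma emeasure_interval_measure_Ioc_finite: "emeasure (interval_measure F) {a<..b} < \<infinity>"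
proof -
  define I :: "(real \<times> real) set" where "I = {(a, b). a \<le> b}"
  define G :: "real \<times> real \<Rightarrow> real set" where "G = (\<lambda>(a, b). {a<..b})"
  define \<mu> where "\<mu> = (\<lambda>(a, b). ennreal (F b - F a))"
  have IM: "interval_measure F = extend_measure UNIV I G \<mu>"
    by (simp add: interval_measure_def I_def G_def \<mu>_def)
  show ?thesis
  proof (cases "a \<le> b")
    case True
    \<comment> \<open>\<open>P\<close> is the condition in the definition of
      \<open>extend_measure\<close>, and the case split follows the conditional there:
      \<open>Eps P\<close> is the extension it selects, the other branch is the null
      measure.\<close>
    define P where "P \<mu>' \<longleftrightarrow> (\<forall>i\<in>I. \<mu>' (G i) = \<mu> i) \<and> measure_space UNIV (sigma_sets UNIV (G`I)) \<mu>'" for \<mu>'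
    show ?thesis
    proof (cases "(\<exists>\<mu>'. P \<mu>') \<and> \<not> (\<forall>i\<in>I. \<mu> i = 0)")
      case *: True
      then have P: "P (Eps P)" using someI_ex[of P] by blast
      then have ms: "measure_space UNIV (sigma_sets UNIV (G`I)) (Eps P)" by (simp add: P_def)
      have ab: "(a, b) \<in> I" using True by (simp add: I_def)
      have eq: "interval_measure F = measure_of UNIV (G`I) (Eps P)"
        using * unfolding IM extend_measure_def P_def by auto
      have "emeasure (interval_measure F) (G (a, b)) = Eps P (G (a, b))"
        using ms ab by (intro emeasure_measure_of[OF eq]) (auto simp: measure_space_def eq)
      also have "\<dots> = ennreal (F b - F a)" using P ab by (auto simp: P_def \<mu>_def)
      finally show ?thesis by (simp add: G_def)
    next
      case False
      then have "interval_measure F = measure_of UNIV (G`I) (\<lambda>_. 0)"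
        unfolding IM extend_measure_def P_def by auto
      then show ?thesis by (simp add: emeasure_sigma)
    qed
  qed auto
qed

lemma finite_measure_completion:
  assumes "finite_measure M" shows "finite_measure (completion M)"
  using assms by (auto intro!: finite_measureI simp: finite_measure.emeasure_finite)

lemma space_arc_length [simp]: "space (arc_length g) = path_image g"
  by (simp add: arc_length_def space_restrict_space)

lemma finite_measure_arc_length:
  fixes g :: "real \<Rightarrow> 'a::metric_space"
  assumes "path g"
  shows "finite_measure (arc_length g)"
proof -
  let ?I = "restrict_space (interval_measure (length_upto g)) {0..1}"
  \<comment> \<open>The closed unit interval is enlarged to a half-open one, the shape that
    generates the Stieltjes measure.\<close>
  have "emeasure (interval_measure (length_upto g)) {0..1} \<le> emeasure (interval_measure (length_upto g)) {-1<..1}"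
    by (intro emeasure_mono) auto
  also have "\<dots> < \<infinity>" by (rule emeasure_interval_measure_Ioc_finite)
  finally have fin: "finite_measure ?I"
    by (intro finite_measureI) (simp add: emeasure_restrict_space space_restrict_space)
  have "g \<in> borel_measurable (restrict_space borel {0..1})"
    using assms by (intro borel_measurable_continuous_on_restrict) (simp add: path_def)
  then have "g \<in> borel_measurable ?I"
    by (simp cong: measurable_cong_sets sets_restrict_space_cong)
  then have "g \<in> ?I \<rightarrow>\<^sub>M restrict_space borel (path_image g)"
    by (intro measurable_restrict_space2) (auto simp: path_image_def space_restrict_space)
  then show ?thesis
    unfolding arc_length_def
    by (intro finite_measure_completion finite_measure.finite_measure_distr[OF fin])
qed

text \<open>Lets Borel functions on the ambient space be composed into functions measurable for arc
  length, despite the restriction to the curve and the completion.\<close>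

lemma measurable_ident_arc_length: "(\<lambda>y. y) \<in> borel_measurable (arc_length g)"
  unfolding arc_length_def
  by (intro measurable_completion) (simp add: measurable_restrict_space1)


section \<open>Stability of the posterior for measurable forward operators\<close>

lemma L2_norm_on_nonneg: "0 \<le> L2_norm_on M f"
  by (simp add: L2_norm_on_def)

text \<open>Write A and B for the two norms. Then |A - B| (A + B) = |A^2 - B^2| is at most \<delta>
  times the integral of |u| + |v|, which by Cauchy-Schwarz against the constant 1 is at most sqrt
  (measure M (space M)) (A + B); the factor A + B cancels.\<close>

lemma L2_norm_on_diff_le:
  assumes "finite_measure M" and [measurable]: "u \<in> borel_measurable M" "v \<in> borel_measurable M"
    and \<delta>: "0 \<le> \<delta>" and uv: "\<And>y. y \<in> space M \<Longrightarrow> cmod (u y - v y) \<le> \<delta>"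
  shows "\<bar>L2_norm_on M u - L2_norm_on M v\<bar> \<le> \<delta> * sqrt (measure M (space M))"
proof -
  interpret finite_measure M by fact
  \<comment> \<open>Square integrability survives a bounded perturbation, because constants are
    integrable for a finite measure.\<close>
  have int_mono: "integrable M (\<lambda>y. (cmod (b y))\<^sup>2)"
    if [measurable]: "a \<in> borel_measurable M" "b \<in> borel_measurable M"
      and int: "integrable M (\<lambda>y. (cmod (a y))\<^sup>2)"
      and ab: "\<And>y. y \<in> space M \<Longrightarrow> cmod (a y - b y) \<le> \<delta>" for a b
  proof (rule Bochner_Integration.integrable_bound)
    show "integrable M (\<lambda>y. 2 * (cmod (a y))\<^sup>2 + 2 * \<delta>\<^sup>2)" using int by auto
    show "AE y in M. norm ((cmod (b y))\<^sup>2) \<le> norm (2 * (cmod (a y))\<^sup>2 + 2 * \<delta>\<^sup>2)"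
    proof (rule AE_I2)
      fix y assume "y \<in> space M"
      have "cmod (b y) \<le> cmod (a y) + cmod (a y - b y)"
        by (metis norm_minus_commute norm_triangle_sub)
      then have "cmod (b y) \<le> cmod (a y) + \<delta>" using ab[OF \<open>y \<in> space M\<close>] by simp
      then have "(cmod (b y))\<^sup>2 \<le> (cmod (a y) + \<delta>)\<^sup>2" by (intro power_mono) auto
      also have "\<dots> \<le> 2 * (cmod (a y))\<^sup>2 + 2 * \<delta>\<^sup>2"
        using zero_le_power2[of "cmod (a y) - \<delta>"] by (simp add: power2_sum power2_diff)
      finally show "norm ((cmod (b y))\<^sup>2) \<le> norm (2 * (cmod (a y))\<^sup>2 + 2 * \<delta>\<^sup>2)" by simp
    qed
  qed auto
  show ?thesis
  proof (cases "integrable M (\<lambda>y. (cmod (u y))\<^sup>2)")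
    case False
    \<comment> \<open>\<open>u\<close> and \<open>v\<close> fail to be square integrable together;
      both integrals are then 0 by default, so the two norms agree.\<close>
    then have "\<not> integrable M (\<lambda>y. (cmod (v y))\<^sup>2)"
      using int_mono[of v u] uv by (auto simp: norm_minus_commute)
    with False show ?thesis
      using \<delta> by (simp add: L2_norm_on_def not_integrable_integral_eq)
  next
    case True
    note u2 = True
    have v2: "integrable M (\<lambda>y. (cmod (v y))\<^sup>2)"
      using int_mono[of u v] uv True by auto
    let ?m = "measure M (space M)"
    have int: "integrable M (\<lambda>y. cmod (w y))"
      and L1: "(\<integral>y. cmod (w y) \<partial>M) \<le> sqrt ?m * L2_norm_on M w"
      if [measurable]: "w \<in> borel_measurable M" and w2: "integrable M (\<lambda>y. (cmod (w y))\<^sup>2)" for w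
    proof -
      show i: "integrable M (\<lambda>y. cmod (w y))"
        by (rule square_integrable_imp_integrable) (use w2 in auto)
      let ?s = "\<integral>y. cmod (w y) \<partial>M"
      \<comment> \<open>Cauchy-Schwarz from the nonnegativity of a variance, scaled by
        \<open>?m\<close> to avoid a division. The common factor \<open>?m\<close> can be cancelled
        only if it is nonzero, hence the case split below.\<close>
      have "0 \<le> (\<integral>y. (?m * cmod (w y) - ?s)\<^sup>2 \<partial>M)" by simp
      also have "\<dots> = (\<integral>y. ?m\<^sup>2 * (cmod (w y))\<^sup>2 - 2 * ?m * ?s * cmod (w y) + ?s\<^sup>2 \<partial>M)"
        by (intro Bochner_Integration.integral_cong) (auto simp: power2_eq_square algebra_simps)
      also have "\<dots> = ?m\<^sup>2 * (\<integral>y. (cmod (w y))\<^sup>2 \<partial>M) - 2 * ?m * ?s * ?s + ?m * ?s\<^sup>2"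
        using w2 i by simp
      also have "\<dots> = ?m * (?m * (\<integral>y. (cmod (w y))\<^sup>2 \<partial>M) - ?s\<^sup>2)"
        by (simp add: power2_eq_square algebra_simps)
      finally have *: "0 \<le> ?m * (?m * (\<integral>y. (cmod (w y))\<^sup>2 \<partial>M) - ?s\<^sup>2)" .
      show "?s \<le> sqrt ?m * L2_norm_on M w"
      proof (cases "?m = 0")
        case True
        then have "space M \<in> null_sets M"
          by (simp add: null_sets_def emeasure_eq_measure)
        then have "AE y in M. cmod (w y) = 0"
          by (auto intro: AE_I')
        then have "?s = 0" by (rule integral_eq_zero_AE)
        then show ?thesis using True by simp
      next
        case False
        then have "?s\<^sup>2 \<le> ?m * (\<integral>y. (cmod (w y))\<^sup>2 \<partial>M)"
          using * by (simp add: zero_le_mult_iff measure_le_0_iff)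
        then show ?thesis
          by (simp add: L2_norm_on_def real_sqrt_mult[symmetric] real_le_rsqrt)
      qed
    qed
    let ?A = "L2_norm_on M u" and ?B = "L2_norm_on M v"
    have sq: "?A\<^sup>2 = (\<integral>y. (cmod (u y))\<^sup>2 \<partial>M)" "?B\<^sup>2 = (\<integral>y. (cmod (v y))\<^sup>2 \<partial>M)"
      by (simp_all add: L2_norm_on_def)
    have "?A\<^sup>2 - ?B\<^sup>2 = (?A - ?B) * (?A + ?B)"
      by (simp add: power2_eq_square square_diff_square_factored mult.commute)
    then have "\<bar>?A - ?B\<bar> * (?A + ?B) = \<bar>?A\<^sup>2 - ?B\<^sup>2\<bar>"
      by (simp add: abs_mult L2_norm_on_nonneg)
    also have "\<dots> = \<bar>\<integral>y. (cmod (u y))\<^sup>2 - (cmod (v y))\<^sup>2 \<partial>M\<bar>"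
      using u2 v2 by (simp add: sq)
    also have "\<dots> \<le> (\<integral>y. \<bar>(cmod (u y))\<^sup>2 - (cmod (v y))\<^sup>2\<bar> \<partial>M)"
      by (rule integral_abs_bound)
    also have "\<dots> \<le> (\<integral>y. \<delta> * (cmod (u y) + cmod (v y)) \<partial>M)"
    proof (rule integral_mono)
      fix y assume y: "y \<in> space M"
      have "\<bar>(cmod (u y))\<^sup>2 - (cmod (v y))\<^sup>2\<bar> = \<bar>cmod (u y) - cmod (v y)\<bar> * (cmod (u y) + cmod (v y))"
        by (simp add: power2_eq_square square_diff_square_factored abs_mult mult.commute)
      also have "\<dots> \<le> \<delta> * (cmod (u y) + cmod (v y))"
        using order_trans[OF norm_triangle_ineq3 uv[OF y]] by (intro mult_right_mono) auto
      finally show "\<bar>(cmod (u y))\<^sup>2 - (cmod (v y))\<^sup>2\<bar> \<le> \<delta> * (cmod (u y) + cmod (v y))" .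
    qed (use u2 v2 int[of u] int[of v] in auto)
    also have "\<dots> = \<delta> * ((\<integral>y. cmod (u y) \<partial>M) + (\<integral>y. cmod (v y) \<partial>M))"
      using u2 v2 int[of u] int[of v] by auto
    also have "\<dots> \<le> \<delta> * (sqrt ?m * ?A + sqrt ?m * ?B)"
      using L1[of u] L1[of v] u2 v2 \<delta> by (intro mult_left_mono add_mono) auto
    also have "\<dots> = \<delta> * sqrt ?m * (?A + ?B)"
      by (simp only: distrib_left mult.assoc)
    finally have *: "\<bar>?A - ?B\<bar> * (?A + ?B) \<le> \<delta> * sqrt ?m * (?A + ?B)" .
    show ?thesis
    proof (cases "?A + ?B = 0")
      case True
      then have "?A = 0" "?B = 0"
        using L2_norm_on_nonneg[of M u] L2_norm_on_nonneg[of M v] by linarith+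
      then show ?thesis using \<delta> by simp
    next
      case False
      then have "?A + ?B > 0"
        using L2_norm_on_nonneg[of M u] L2_norm_on_nonneg[of M v] by linarith
      with * show ?thesis by simp
    qed
  qed
qed

section \<open>Elementary Lipschitz estimates\<close>

lemma exp_neg_square_lipschitz:
  fixes c s t :: real
  assumes "0 < c"
  shows "\<bar>exp (- (c * s\<^sup>2)) - exp (- (c * t\<^sup>2))\<bar> \<le> sqrt c * \<bar>s - t\<bar>"
proof -
  have "norm (exp (- (c * s\<^sup>2)) - exp (- (c * t\<^sup>2))) \<le> sqrt c * norm (s - t)"
  proof (rule field_differentiable_bound[of UNIV "\<lambda>x. exp (- (c * x\<^sup>2))" "\<lambda>x. - 2 * c * x * exp (- (c * x\<^sup>2))"])
    fix x :: real
    show "((\<lambda>x. exp (- (c * x\<^sup>2))) has_field_derivative - 2 * c * x * exp (- (c * x\<^sup>2))) (at x within UNIV)"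
      by (auto intro!: derivative_eq_intros)
    \<comment> \<open>In terms of \<open>u\<close> the derivative has absolute value
      \<open>sqrt c * (2 * u * exp (- u^2))\<close>, and 2 u \<le> 1 + u^2 \<le> exp (u^2).\<close>
    define u where "u = sqrt c * \<bar>x\<bar>"
    have u: "u\<^sup>2 = c * x\<^sup>2" using assms by (simp add: u_def power_mult_distrib)
    have "2 * u \<le> 1 + u\<^sup>2" using zero_le_power2[of "u - 1"] by (simp add: power2_diff)
    also have "\<dots> \<le> exp (u\<^sup>2)" by (rule exp_ge_add_one_self)
    finally have "2 * u * exp (- u\<^sup>2) \<le> 1" by (simp add: exp_minus field_simps)
    then have "sqrt c * (2 * u * exp (- u\<^sup>2)) \<le> sqrt c" using assms by simp
    moreover have "c = sqrt c * sqrt c" using assms by simp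
    then have "2 * c * \<bar>x\<bar> = sqrt c * (2 * u)" unfolding u_def by algebra
    then have "norm (- 2 * c * x * exp (- (c * x\<^sup>2))) = sqrt c * (2 * u * exp (- u\<^sup>2))"
      using assms by (simp add: u abs_mult)
    ultimately show "norm (- 2 * c * x * exp (- (c * x\<^sup>2))) \<le> sqrt c"
      by simp
  qed auto
  then show ?thesis by simp
qed

text \<open>Meant for \<open>a\<close> the square root of a likelihood and \<open>L\<close> its
  evidence. Changing the numerator costs \<open>e / sqrt l0\<close>. Changing the normalisation
  costs \<open>e / (l0 * sqrt l0)\<close>, since |sqrt L' - sqrt L| = |L - L'| / (sqrt L' + sqrt L)
  \<le> e / sqrt l0.\<close>

lemma normalize_diff_le:
  fixes a a' L L' l0 e :: real
  assumes "0 \<le> a'" "a' \<le> 1" "0 < l0" "l0 \<le> L" "l0 \<le> L'"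
    and a: "\<bar>a - a'\<bar> \<le> e" and L: "\<bar>L - L'\<bar> \<le> 2 * e"
  shows "\<bar>a / sqrt L - a' / sqrt L'\<bar> \<le> e * (1 / sqrt l0 + 1 / (l0 * sqrt l0))"
proof -
  have pos: "0 < L" "0 < L'" using assms by linarith+
  have s: "0 < sqrt l0" "sqrt l0 \<le> sqrt L" "sqrt l0 \<le> sqrt L'" using assms by auto
  have e: "0 \<le> e" using a by linarith
  have "\<bar>sqrt L' - sqrt L\<bar> * (sqrt L' + sqrt L) = \<bar>(sqrt L' - sqrt L) * (sqrt L' + sqrt L)\<bar>"
    using pos by (simp add: abs_mult)
  also have "\<dots> = \<bar>L - L'\<bar>" using pos by (simp add: algebra_simps abs_minus_commute)
  finally have "\<bar>sqrt L' - sqrt L\<bar> * (sqrt L' + sqrt L) \<le> 2 * e" using L by simp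
  moreover have "\<bar>sqrt L' - sqrt L\<bar> * (2 * sqrt l0) \<le> \<bar>sqrt L' - sqrt L\<bar> * (sqrt L' + sqrt L)"
    by (rule mult_left_mono) (use s in linarith, simp)
  ultimately have d: "\<bar>sqrt L' - sqrt L\<bar> \<le> e / sqrt l0"
    using s by (simp add: field_simps)
  have "a / sqrt L - a' / sqrt L' = (a - a') / sqrt L + a' * ((sqrt L' - sqrt L) / (sqrt L * sqrt L'))"
    using pos by (simp add: field_simps)
  also have "\<bar>\<dots>\<bar> \<le> \<bar>(a - a') / sqrt L\<bar> + \<bar>a' * ((sqrt L' - sqrt L) / (sqrt L * sqrt L'))\<bar>"
    by (rule abs_triangle_ineq)
  also have "\<dots> \<le> e / sqrt l0 + 1 * ((e / sqrt l0) / (sqrt l0 * sqrt l0))"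
  proof (rule add_mono)
    show "\<bar>(a - a') / sqrt L\<bar> \<le> e / sqrt l0"
      using a s pos by (simp add: abs_div frac_le)
    have "\<bar>(sqrt L' - sqrt L) / (sqrt L * sqrt L')\<bar> \<le> (e / sqrt l0) / (sqrt l0 * sqrt l0)"
      unfolding abs_divide using d s pos e
      by (intro frac_le) (simp_all only: abs_mult real_sqrt_abs2 abs_of_pos real_sqrt_gt_zero mult_mono mult_pos_pos less_imp_le divide_nonneg_pos)
    then show "\<bar>a' * ((sqrt L' - sqrt L) / (sqrt L * sqrt L'))\<bar> \<le> 1 * ((e / sqrt l0) / (sqrt l0 * sqrt l0))"
      unfolding abs_mult using assms by (intro mult_mono) auto
  qed
  also have "\<dots> = e * (1 / sqrt l0 + 1 / (l0 * sqrt l0))"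
    using assms by (simp add: field_simps)
  finally show ?thesis .
qed

section \<open>Distances between measures given by densities\<close>

lemma AE_RN_deriv_density_real:
  assumes "prob_space \<mu>" and [measurable]: "f \<in> borel_measurable \<mu>"
    and "\<And>p. 0 \<le> f p"
  shows "AE p in \<mu>. enn2real (RN_deriv \<mu> (density \<mu> (\<lambda>p. ennreal (f p))) p) = f p"
proof -
  interpret prob_space \<mu> by fact
  have "AE p in \<mu>. ennreal (f p) = RN_deriv \<mu> (density \<mu> (\<lambda>p. ennreal (f p))) p"
    by (rule RN_deriv_unique) auto
  then show ?thesis
    by eventually_elim (metis assms(3) enn2real_ennreal)
qed

text \<open>A pointwise bound on the difference of square roots integrates to the Hellinger bound,
  as the total mass is 1. For total variation, |f - f'| factors as |sqrt f - sqrt f'| (sqrt f + sqrt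
  f') \<le> 2 d sqrt B, and the 2 cancels against the factor 1/2 in \<open>tv_dist\<close>.\<close>

lemma hellinger_tv_dist_density_le:
  fixes f f' :: "'p \<Rightarrow> real"
  assumes "prob_space \<mu>" and [measurable]: "f \<in> borel_measurable \<mu>" "f' \<in> borel_measurable \<mu>"
    and nn: "\<And>p. 0 \<le> f p" "\<And>p. 0 \<le> f' p"
    and bd: "\<And>p. f p \<le> B" "\<And>p. f' p \<le> B"
    and d: "\<And>p. \<bar>sqrt (f p) - sqrt (f' p)\<bar> \<le> d"
  shows "hellinger_dist \<mu> (density \<mu> (\<lambda>p. ennreal (f p))) (density \<mu> (\<lambda>p. ennreal (f' p))) \<le> d"
    and "tv_dist \<mu> (density \<mu> (\<lambda>p. ennreal (f p))) (density \<mu> (\<lambda>p. ennreal (f' p))) \<le> d * sqrt B"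
proof -
  interpret prob_space \<mu> by fact
  let ?\<mu>1 = "density \<mu> (\<lambda>p. ennreal (f p))" and ?\<mu>2 = "density \<mu> (\<lambda>p. ennreal (f' p))"
  note RN = AE_RN_deriv_density_real[OF \<open>prob_space \<mu>\<close> assms(2) nn(1)]
    AE_RN_deriv_density_real[OF \<open>prob_space \<mu>\<close> assms(3) nn(2)]
  have d0: "0 \<le> d" using d by (meson abs_ge_zero order_trans)
  have int: "(\<integral>p. h p \<partial>\<mu>) \<le> C" if "\<And>p. 0 \<le> h p" "\<And>p. h p \<le> C" "h \<in> borel_measurable \<mu>"
    for h :: "'p \<Rightarrow> real" and C
  proof -
    have "integrable \<mu> h" using that by (intro integrable_const_bound[where B = C]) auto
    then show ?thesis using that by (intro integral_le_const) auto
  qed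
  have "(\<integral>p. (sqrt (enn2real (RN_deriv \<mu> ?\<mu>1 p)) - sqrt (enn2real (RN_deriv \<mu> ?\<mu>2 p)))\<^sup>2 \<partial>\<mu>)
      = (\<integral>p. (sqrt (f p) - sqrt (f' p))\<^sup>2 \<partial>\<mu>)"
    by (rule integral_cong_AE) (use RN in \<open>auto elim!: eventually_elim2\<close>)
  also have "\<dots> \<le> d\<^sup>2"
    using power_mono[OF d, where n = 2] by (intro int) auto
  finally have "hellinger_dist \<mu> ?\<mu>1 ?\<mu>2 \<le> sqrt (1 / 2 * d\<^sup>2)"
    unfolding hellinger_dist_def by simp
  also have "\<dots> \<le> sqrt (d\<^sup>2)" by (intro real_sqrt_le_mono) simp
  finally show "hellinger_dist \<mu> ?\<mu>1 ?\<mu>2 \<le> d" using d0 by simp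
  have B: "sqrt (f p) + sqrt (f' p) \<le> 2 * sqrt B" for p
    using bd[of p] real_sqrt_le_mono by (smt (verit))
  have "(\<integral>p. \<bar>enn2real (RN_deriv \<mu> ?\<mu>1 p) - enn2real (RN_deriv \<mu> ?\<mu>2 p)\<bar> \<partial>\<mu>)
      = (\<integral>p. \<bar>f p - f' p\<bar> \<partial>\<mu>)"
    by (rule integral_cong_AE) (use RN in \<open>auto elim!: eventually_elim2\<close>)
  also have "\<dots> \<le> d * (2 * sqrt B)"
  proof (rule int)
    fix p
    have "\<bar>f p - f' p\<bar> = \<bar>(sqrt (f p) - sqrt (f' p)) * (sqrt (f p) + sqrt (f' p))\<bar>"
      using nn[of p] by (simp add: algebra_simps)
    also have "\<dots> = \<bar>sqrt (f p) - sqrt (f' p)\<bar> * (sqrt (f p) + sqrt (f' p))"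
      using nn[of p] by (simp add: abs_mult)
    also have "\<dots> \<le> d * (2 * sqrt B)"
      using d[of p] B[of p] d0 nn[of p] by (intro mult_mono) auto
    finally show "\<bar>f p - f' p\<bar> \<le> d * (2 * sqrt B)" .
  qed auto
  finally show "tv_dist \<mu> ?\<mu>1 ?\<mu>2 \<le> d * sqrt B"
    unfolding tv_dist_def by simp
qed


text \<open>No integrability is assumed of \<open>K p\<close>: where \<open>K p\<close> is not square integrable, neither is
  any \<open>Y - K p\<close> with \<open>Y\<close> bounded, so that the misfit is \<open>0\<close> for all data.\<close>

lemma bayes_well_posedI:
  fixes \<mu>0 :: "'p::topological_space measure" and g :: "real \<Rightarrow> real^2"
  assumes \<mu>0: "prob_space \<mu>0" and sets_\<mu>0 [measurable_cong]: "sets \<mu>0 = sets borel"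
    and g: "path g" and \<gamma>: "0 < \<gamma>"
    and K: "(\<lambda>(p, y). K p y) \<in> borel_measurable (borel \<Otimes>\<^sub>M borel)"
  shows "bayes_well_posed \<mu>0 g K \<gamma>"
proof -
  interpret prob_space \<mu>0 by fact
  define A where "A = arc_length g"
  define m where "m = sqrt (measure A (space A))"
  \<comment> \<open>Half the factor in \<open>misfit\<close>, so that \<open>a\<close> below is the
    square root of the likelihood.\<close>
  define c where "c = 1 / (4 * \<gamma>\<^sup>2)"
  define a where "a Y p = exp (- (c * (L2_norm_on A (\<lambda>y. Y y - K p y))\<^sup>2))" for Y p
  define L where "L Y = (\<integral>p. (a Y p)\<^sup>2 \<partial>\<mu>0)" for Y
  have space_A: "space A = path_image g" by (simp add: A_def)
  interpret A: finite_measure A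
    unfolding A_def using g by (rule finite_measure_arc_length)
  have c: "0 < c" using \<gamma> by (simp add: c_def)
  have m: "0 \<le> m" by (simp add: m_def)
  have id_A: "(\<lambda>y. y) \<in> A \<rightarrow>\<^sub>M borel" unfolding A_def by (rule measurable_ident_arc_length)
  \<comment> \<open>Joint measurability is what makes the norm over \<open>A\<close> a measurable
    function of \<open>p\<close>.\<close>
  have K_joint [measurable]: "(\<lambda>(p, y). K p y) \<in> borel_measurable (\<mu>0 \<Otimes>\<^sub>M A)"
  proof -
    have "(\<lambda>x. (fst x, snd x)) \<in> \<mu>0 \<Otimes>\<^sub>M A \<rightarrow>\<^sub>M borel \<Otimes>\<^sub>M borel"
      using id_A by (intro measurable_Pair measurable_compose[OF measurable_snd id_A])
        (simp_all add: measurable_fst cong: measurable_cong_sets)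
    from measurable_compose[OF this K] show ?thesis by (simp add: case_prod_beta')
  qed
  have space_\<mu>0: "space \<mu>0 = UNIV" using sets_eq_imp_space_eq[OF sets_\<mu>0] by simp
  have K_meas: "K p \<in> borel_measurable A" for p
    using measurable_compose[OF measurable_Pair1'[of p \<mu>0 A] K_joint] by (simp add: space_\<mu>0)
  have data [simp]: "(\<lambda>y. Y y - K p y) \<in> borel_measurable A" if "Y \<in> borel_measurable A" for Y p
    using that K_meas[of p] by simp
  have L2_meas: "(\<lambda>p. L2_norm_on A (\<lambda>y. Y y - K p y)) \<in> borel_measurable \<mu>0"
    if [measurable]: "Y \<in> borel_measurable A" for Y
  proof -
    have "(\<lambda>p. \<integral>y. (cmod (Y y - K p y))\<^sup>2 \<partial>A) \<in> borel_measurable \<mu>0"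
      by (rule A.borel_measurable_lebesgue_integral) measurable
    then show ?thesis unfolding L2_norm_on_def by measurable
  qed
  have a_meas [measurable]: "a Y \<in> borel_measurable \<mu>0" if "Y \<in> borel_measurable A" for Y
    unfolding a_def using L2_meas[OF that] by measurable
  have a01: "0 \<le> a Y p" "a Y p \<le> 1" for Y p
    using c by (auto simp: a_def)
  have a2_int: "integrable \<mu>0 (\<lambda>p. (a Y p)\<^sup>2)" if "Y \<in> borel_measurable A" for Y
    using a01[of Y] a_meas[OF that]
    by (intro integrable_const_bound[where B = 1]) (auto simp: power_le_one)
  have a2: "exp (- misfit g K \<gamma> Y p) = (a Y p)\<^sup>2" for Y p
    by (simp add: a_def misfit_def A_def c_def power2_eq_square flip: exp_add)
  have evidence: "evidence \<mu>0 g K \<gamma> Y = L Y" for Y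
    by (simp add: evidence_def L_def a2)
  have posterior: "posterior \<mu>0 g K \<gamma> Y = density \<mu>0 (\<lambda>p. ennreal ((a Y p)\<^sup>2 / L Y))" for Y
    by (simp add: posterior_def evidence a2)

  show ?thesis
    unfolding bayes_well_posed_def
  proof (intro allI impI)
    fix r :: real assume r: "0 < r"
    \<comment> \<open>A lower bound for the likelihood of all data bounded by \<open>r\<close>,
      obtained by comparison with zero data. The factor \<open>2 * c\<close> is that of the full
      misfit, because the likelihood is the square of \<open>a\<close>.\<close>
    define l where "l p = exp (- (2 * c * (L2_norm_on A (\<lambda>y. 0 - K p y) + r * m)\<^sup>2))" for p
    define l0 where "l0 = (\<integral>p. l p \<partial>\<mu>0)"
    have l_meas [measurable]: "l \<in> borel_measurable \<mu>0"
      unfolding l_def using L2_meas[of "\<lambda>_. 0"] by measurable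
    have l_int: "integrable \<mu>0 l"
      using c by (intro integrable_const_bound[where B = 1]) (auto simp: l_def)
    \<comment> \<open>\<open>l\<close> may come arbitrarily close to 0, as the norm of
      \<open>K p\<close> may be unbounded in \<open>p\<close>; but a function that is positive
      everywhere has a positive integral over a probability measure.\<close>
    have l0: "0 < l0"
    proof -
      have "l0 \<noteq> 0"
      proof
        assume "l0 = 0"
        then have "AE p in \<mu>0. l p = 0"
          unfolding l0_def using l_int by (subst (asm) integral_nonneg_eq_0_iff_AE) (auto simp: l_def)
        then show False by (simp add: l_def AE_False)
      qed
      moreover have "0 \<le> l0" unfolding l0_def by (intro integral_nonneg_AE) (simp add: l_def)
      ultimately show ?thesis by simp
    qed
    have L_ge: "l0 \<le> L Y"
      if Y: "Y \<in> borel_measurable A" and Yr: "\<And>y. y \<in> space A \<Longrightarrow> cmod (Y y) \<le> r" for Y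
      unfolding l0_def L_def
    proof (intro integral_mono l_int a2_int Y)
      fix p
      have "\<bar>L2_norm_on A (\<lambda>y. Y y - K p y) - L2_norm_on A (\<lambda>y. 0 - K p y)\<bar> \<le> r * m"
        unfolding m_def using r Y Yr by (intro L2_norm_on_diff_le A.finite_measure_axioms data) auto
      then have "(L2_norm_on A (\<lambda>y. Y y - K p y))\<^sup>2 \<le> (L2_norm_on A (\<lambda>y. 0 - K p y) + r * m)\<^sup>2"
        by (intro power_mono L2_norm_on_nonneg) linarith
      then show "l p \<le> (a Y p)\<^sup>2"
        using c by (simp add: l_def a_def power2_eq_square flip: exp_add)
    qed

    \<comment> \<open>\<open>normalize_diff_le\<close> with
      \<open>e = sqrt c * m * \<delta>\<close>, where \<open>sqrt c\<close> is the Lipschitz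
      constant of the Gaussian and \<open>m * \<delta>\<close> bounds the change of the
      norm.\<close>
    define C where "C = sqrt c * m * (1 / sqrt l0 + 1 / (l0 * sqrt l0))"
    \<comment> \<open>The root of \<open>1 / l0\<close> enters through the total variation bound,
      since \<open>1 / l0\<close> bounds the densities; the summand 1 keeps \<open>M\<close>
      positive when the curve has length 0 and so \<open>C = 0\<close>.\<close>
    define M where "M = C * (1 + sqrt (1 / l0)) + 1"
    have C: "0 \<le> C" using c m l0 by (simp add: C_def)
    have M: "0 < M" "C \<le> M" "C * sqrt (1 / l0) \<le> M"
      using C l0 by (simp_all add: M_def distrib_left add_nonneg_pos)
    have *: "hellinger_dist \<mu>0 (posterior \<mu>0 g K \<gamma> Y) (posterior \<mu>0 g K \<gamma> Y')
          \<le> M * sup_norm_on (path_image g) (\<lambda>y. Y y - Y' y) \<and>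
        tv_dist \<mu>0 (posterior \<mu>0 g K \<gamma> Y) (posterior \<mu>0 g K \<gamma> Y')
          \<le> M * sup_norm_on (path_image g) (\<lambda>y. Y y - Y' y)"
      if bm: "bounded_measurable_data g Y" "bounded_measurable_data g Y'"
        and sup: "max (sup_norm_on (path_image g) Y) (sup_norm_on (path_image g) Y') < r" for Y Y'
    proof -
      have Y: "Y \<in> borel_measurable A" "Y' \<in> borel_measurable A"
        and bd: "bounded (Y ` path_image g)" "bounded (Y' ` path_image g)"
        using bm by (auto simp: bounded_measurable_data_def A_def)
      have le_sup: "cmod (Z y) \<le> sup_norm_on (path_image g) Z"
        if "bounded (Z ` path_image g)" "y \<in> path_image g" for Z y
        unfolding sup_norm_on_def using that
        by (intro cSUP_upper) (auto simp: bounded_iff bdd_above_def)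
      define \<delta> where "\<delta> = sup_norm_on (path_image g) (\<lambda>y. Y y - Y' y)"
      have \<delta>_ge: "cmod (Y y - Y' y) \<le> \<delta>" if "y \<in> path_image g" for y
        unfolding \<delta>_def using that bd by (intro le_sup bounded_minus_comp) auto
      have \<delta>: "0 \<le> \<delta>"
        using \<delta>_ge path_image_nonempty[of g] by (meson all_not_in_conv norm_ge_zero order_trans)
      have Lge: "l0 \<le> L Y" "l0 \<le> L Y'"
        using sup order_trans[OF le_sup[OF bd(1)]] order_trans[OF le_sup[OF bd(2)]]
        by (auto intro!: L_ge Y simp: space_A)
      have a_diff: "\<bar>a Y p - a Y' p\<bar> \<le> sqrt c * m * \<delta>" for p
      proof -
        have "\<bar>a Y p - a Y' p\<bar>
            \<le> sqrt c * \<bar>L2_norm_on A (\<lambda>y. Y y - K p y) - L2_norm_on A (\<lambda>y. Y' y - K p y)\<bar>"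
          unfolding a_def by (rule exp_neg_square_lipschitz[OF c])
        also have "\<dots> \<le> sqrt c * (\<delta> * m)"
          unfolding m_def using \<delta> Y \<delta>_ge c
          by (intro mult_left_mono L2_norm_on_diff_le A.finite_measure_axioms data) (auto simp: space_A)
        finally show ?thesis by (simp add: mult_ac)
      qed
      \<comment> \<open>As \<open>a\<close> takes values in [0, 1], squaring at most doubles the
        difference; this is the \<open>2 * e\<close> of \<open>normalize_diff_le\<close>.\<close>
      have L_diff: "\<bar>L Y - L Y'\<bar> \<le> 2 * (sqrt c * m * \<delta>)"
      proof -
        have "\<bar>L Y - L Y'\<bar> = \<bar>\<integral>p. (a Y p)\<^sup>2 - (a Y' p)\<^sup>2 \<partial>\<mu>0\<bar>"
          unfolding L_def using a2_int Y by simp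
        also have "\<dots> \<le> (\<integral>p. \<bar>(a Y p)\<^sup>2 - (a Y' p)\<^sup>2\<bar> \<partial>\<mu>0)"
          by (rule integral_abs_bound)
        also have "\<dots> \<le> 2 * (sqrt c * m * \<delta>)"
        proof (rule integral_le_const)
          show "integrable \<mu>0 (\<lambda>p. \<bar>(a Y p)\<^sup>2 - (a Y' p)\<^sup>2\<bar>)" using a2_int Y by simp
          show "AE p in \<mu>0. \<bar>(a Y p)\<^sup>2 - (a Y' p)\<^sup>2\<bar> \<le> 2 * (sqrt c * m * \<delta>)"
          proof (rule AE_I2)
            fix p
            have "\<bar>(a Y p)\<^sup>2 - (a Y' p)\<^sup>2\<bar> = (a Y p + a Y' p) * \<bar>a Y p - a Y' p\<bar>"
              using a01 by (simp add: power2_eq_square square_diff_square_factored abs_mult)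
            also have "\<dots> \<le> 2 * (sqrt c * m * \<delta>)"
              using a_diff[of p] a01[of Y p] a01[of Y' p] by (intro mult_mono) auto
            finally show "\<bar>(a Y p)\<^sup>2 - (a Y' p)\<^sup>2\<bar> \<le> 2 * (sqrt c * m * \<delta>)" .
          qed
        qed
        finally show ?thesis .
      qed
      have sqrt_diff: "\<bar>sqrt ((a Y p)\<^sup>2 / L Y) - sqrt ((a Y' p)\<^sup>2 / L Y')\<bar> \<le> C * \<delta>" for p
        using normalize_diff_le[OF a01(1,2) l0 Lge a_diff L_diff, of p] a01
        by (simp add: real_sqrt_divide C_def mult_ac)
      have bound: "(a Z p)\<^sup>2 / L Z \<le> 1 / l0" if "l0 \<le> L Z" for Z p
        using a01[of Z p] l0 that by (intro frac_le) (auto simp: power_le_one)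
      have "(\<lambda>p. (a Z p)\<^sup>2 / L Z) \<in> borel_measurable \<mu>0" if "Z \<in> borel_measurable A" for Z
        using a_meas[OF that] by measurable
      moreover have "0 \<le> (a Z p)\<^sup>2 / L Z" if "l0 \<le> L Z" for Z p
        using that l0 by simp
      ultimately have "hellinger_dist \<mu>0 (posterior \<mu>0 g K \<gamma> Y) (posterior \<mu>0 g K \<gamma> Y') \<le> C * \<delta>"
        and "tv_dist \<mu>0 (posterior \<mu>0 g K \<gamma> Y) (posterior \<mu>0 g K \<gamma> Y') \<le> C * \<delta> * sqrt (1 / l0)"
        unfolding posterior using Y Lge bound sqrt_diff
        by (auto intro!: hellinger_tv_dist_density_le(1) hellinger_tv_dist_density_le(2) \<mu>0)
      moreover have "C * \<delta> \<le> M * \<delta>" "C * \<delta> * sqrt (1 / l0) \<le> M * \<delta>"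
        using mult_right_mono[OF M(2) \<delta>] mult_right_mono[OF M(3) \<delta>] by (simp_all add: mult_ac)
      ultimately show ?thesis unfolding \<delta>_def by linarith
    qed
    show "\<exists>M>0. \<forall>Y Y'.
        bounded_measurable_data g Y \<and> bounded_measurable_data g Y' \<and>
        max (sup_norm_on (path_image g) Y) (sup_norm_on (path_image g) Y') < r \<and>
        absolutely_continuous \<mu>0 (posterior \<mu>0 g K \<gamma> Y) \<and>
        absolutely_continuous \<mu>0 (posterior \<mu>0 g K \<gamma> Y') \<longrightarrow>
        hellinger_dist \<mu>0 (posterior \<mu>0 g K \<gamma> Y) (posterior \<mu>0 g K \<gamma> Y')
          \<le> M * sup_norm_on (path_image g) (\<lambda>y. Y y - Y' y) \<and>
        tv_dist \<mu>0 (posterior \<mu>0 g K \<gamma> Y) (posterior \<mu>0 g K \<gamma> Y')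
          \<le> M * sup_norm_on (path_image g) (\<lambda>y. Y y - Y' y)"
      using M(1) * by blast
  qed
qed

section \<open>Measurability of the forward operators\<close>

text \<open>The coefficients are dominated by those of the exponential series. The allowance
  \<open>fact m\<close> covers both the signs in \<open>bessel_J0\<close> and the harmonic numbers
  in \<open>bessel_Y0\<close>.\<close>

lemma summable_power_over_fact_square:
  fixes c :: "nat \<Rightarrow> real" and x :: real
  assumes "\<And>m. \<bar>c m\<bar> \<le> fact m"
  shows "summable (\<lambda>m. c m / (fact m)\<^sup>2 * x ^ m)"
proof (rule summable_comparison_test'[where N = 0])
  show "summable (\<lambda>m. inverse (fact m) * \<bar>x\<bar> ^ m)" by (rule summable_exp)
  fix m :: nat
  have "\<bar>c m\<bar> / (fact m)\<^sup>2 \<le> fact m / (fact m)\<^sup>2"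
    using assms by (intro divide_right_mono) auto
  also have "\<dots> = inverse (fact m)" by (simp add: power2_eq_square field_simps)
  finally show "norm (c m / (fact m)\<^sup>2 * x ^ m) \<le> inverse (fact m) * \<bar>x\<bar> ^ m"
    by (simp add: abs_mult power_abs mult_right_mono del: times_divide_eq_left)
qed

lemma harm_le_fact: "harm m \<le> (fact m :: real)"
proof -
  have "harm m \<le> real m"
  proof (induction m)
    case (Suc m)
    have "inverse (real (Suc m)) \<le> 1" by (simp add: field_simps)
    with Suc show ?case by (simp add: harm_Suc)
  qed (simp add: harm_def)
  also have "real m \<le> fact m"
    by (metis fact_ge_self of_nat_fact of_nat_le_iff)
  finally show ?thesis .
qed

text \<open>An everywhere convergent power series evaluated at (x / 2)^2, so termwise
  differentiation and the chain rule apply.\<close>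

lemma differentiable_power_over_fact_square:
  fixes c :: "nat \<Rightarrow> real" and x :: real
  assumes "\<And>m. \<bar>c m\<bar> \<le> fact m"
  shows "(\<lambda>x. \<Sum>m. c m / (fact m)\<^sup>2 * (x / 2) ^ (2 * m)) differentiable (at x)"
proof -
  let ?P = "\<lambda>x. \<Sum>m. c m / (fact m)\<^sup>2 * x ^ m"
  have "?P differentiable (at y)" for y
    using termdiffs_strong_converges_everywhere[OF summable_power_over_fact_square[OF assms]]
    unfolding real_differentiable_def by blast
  moreover have "(\<lambda>x. (x / 2)\<^sup>2) differentiable (at x)" by simp
  ultimately have "(\<lambda>x. ?P ((x / 2)\<^sup>2)) differentiable (at x)"
    using differentiable_chain_at[of "\<lambda>x. (x / 2)\<^sup>2" x ?P] unfolding o_def by blast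
  then show ?thesis unfolding power_mult .
qed

section \<open>Regularity of the Hankel function and the fundamental solution\<close>

lemma bessel_J0_differentiable: "bessel_J0 differentiable (at x)"
  unfolding bessel_J0_def[abs_def] by (rule differentiable_power_over_fact_square[of "\<lambda>m. (-1) ^ m"]) (simp add: power_abs)

lemma bessel_Y0_differentiable:
  assumes "0 < x" shows "bessel_Y0 differentiable (at x)"
proof -
  have "ln differentiable (at (x / 2))"
    using assms DERIV_ln[of "x / 2"] unfolding real_differentiable_def by auto
  moreover have "(\<lambda>x. x / 2) differentiable (at x)" by simp
  ultimately have "(\<lambda>x. ln (x / 2)) differentiable (at x)"
    using differentiable_chain_at[of "\<lambda>x. x / 2" x ln] unfolding o_def by blast
  moreover have "(\<lambda>x. \<Sum>m. (-1) ^ (m + 1) * harm m / (fact m)\<^sup>2 * (x / 2) ^ (2 * m)) differentiable (at x)"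
    by (rule differentiable_power_over_fact_square[of "\<lambda>m. (-1) ^ (m + 1) * harm m"])
      (simp add: abs_mult power_abs harm_nonneg harm_le_fact)
  ultimately show ?thesis
    unfolding bessel_Y0_def[abs_def] using bessel_J0_differentiable by simp
qed

lemma hankel1_0_differentiable:
  assumes "0 < x" shows "hankel1_0 differentiable (at x)"
proof -
  have "(\<lambda>x. of_real (f x) :: complex) differentiable (at x)" if "f differentiable (at x)" for f :: "real \<Rightarrow> real"
    using that unfolding differentiable_def by (blast intro: has_derivative_of_real)
  then have "(\<lambda>x. of_real (bessel_J0 x) + \<i> * of_real (bessel_Y0 x)) differentiable (at x)"
    using bessel_J0_differentiable bessel_Y0_differentiable[OF assms]
    by (intro differentiable_add differentiable_mult) auto
  then show ?thesis by (simp add: hankel1_0_def[abs_def] Complex_eq)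
qed

lemma hankel1_0_measurable [measurable]: "hankel1_0 \<in> borel_measurable borel"
proof -
  have [measurable]: "bessel_J0 \<in> borel_measurable borel" "bessel_Y0 \<in> borel_measurable borel"
    unfolding bessel_J0_def[abs_def] bessel_Y0_def[abs_def] by measurable
  show ?thesis
    unfolding hankel1_0_def[abs_def] Complex_eq by measurable
qed

lemma Phi_measurable [measurable]: "(\<lambda>(y, x). Phi k y x) \<in> borel_measurable (borel \<Otimes>\<^sub>M borel)"
  unfolding Phi_def by measurable

lemma Phi_differentiable:
  assumes "0 < k" "x \<noteq> 0" shows "Phi k 0 differentiable (at x)"
proof -
  have "(\<lambda>x::real^2. k * norm (0 - x)) differentiable (at x)"
    using assms by (auto intro!: differentiable_mult differentiable_norm_at)
  moreover have "hankel1_0 differentiable (at (k * norm (0 - x)))"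
    using assms by (intro hankel1_0_differentiable) simp
  ultimately have "(\<lambda>x. hankel1_0 (k * norm (0 - x))) differentiable (at x)"
    using differentiable_chain_at[of "\<lambda>x. k * norm (0 - x)" x hankel1_0] unfolding o_def by blast
  then show ?thesis unfolding Phi_def[abs_def] by simp
qed

text \<open>Both sides choose from the same set of candidate derivatives, so they agree even where
  that set is empty and the choice is unspecified.\<close>

lemma grad_translate: "grad (\<lambda>x. f (x - y)) z = grad f (z - y)"
proof -
  have "((\<lambda>x. f (x - y)) has_derivative D) (at z) \<longleftrightarrow> (f has_derivative D) (at (z - y))" for D
  proof
    assume "((\<lambda>x. f (x - y)) has_derivative D) (at z)"
    then have "((\<lambda>x. f (x - y)) has_derivative D) (at ((z - y) + y))" by simp
    from has_derivative_compose[of "\<lambda>x. x + y" "\<lambda>h. h" "z - y" UNIV, OF _ this]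
    moreover have "((\<lambda>x. x + y) has_derivative (\<lambda>h. h)) (at (z - y))"
      by (auto intro!: derivative_eq_intros)
    ultimately show "(f has_derivative D) (at (z - y))" by simp
  next
    assume "(f has_derivative D) (at (z - y))"
    from has_derivative_compose[of "\<lambda>x. x - y" "\<lambda>h. h" z UNIV, OF _ this]
    moreover have "((\<lambda>x. x - y) has_derivative (\<lambda>h. h)) (at z)"
      by (auto intro!: derivative_eq_intros)
    ultimately show "((\<lambda>x. f (x - y)) has_derivative D) (at z)" by simp
  qed
  then show ?thesis by (simp add: grad_def frechet_derivative_def)
qed

text \<open>Reduces a gradient depending on two points to one function of their difference, so that
  joint measurability follows from measurability in a single variable. The identity includes the
  singular case \<open>z = y\<close>.\<close>

lemma grad_Phi: "grad (\<lambda>x. Phi k y x) z = grad (Phi k 0) (z - y)"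
proof -
  have "(\<lambda>x. Phi k y x) = (\<lambda>x. Phi k 0 (x - y))"
    by (simp add: Phi_def fun_eq_iff norm_minus_commute)
  then show ?thesis by (simp add: grad_translate)
qed

text \<open>Off the origin the partial derivatives are limits of difference quotients; the value at the
  origin, where the Frechet derivative is unspecified, does not matter for measurability.\<close>

lemma grad_measurable:
  fixes f :: "real^2 \<Rightarrow> complex"
  assumes [measurable]: "f \<in> borel_measurable borel"
    and f: "\<And>x. x \<noteq> 0 \<Longrightarrow> f differentiable (at x)"
  shows "(\<lambda>x. grad f x $ i) \<in> borel_measurable borel"
proof -
  let ?q = "\<lambda>n x. real (Suc n) *\<^sub>R (f (x + (1 / real (Suc n)) *\<^sub>R axis i 1) - f x)"
  have "(\<lambda>n. ?q n x) \<longlonglongrightarrow> grad f x $ i" if "x \<noteq> 0" for x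
  proof -
    let ?D = "frechet_derivative f (at x)" and ?h = "\<lambda>n. (1 / real (Suc n)) *\<^sub>R axis i 1 :: real^2"
    have D: "(f has_derivative ?D) (at x)"
      using f[OF that] by (simp add: frechet_derivative_works)
    then interpret bounded_linear ?D by (rule has_derivative_bounded_linear)
    have "(\<lambda>n. x + ?h n) \<longlonglongrightarrow> x + 0 *\<^sub>R axis i 1"
      by (intro tendsto_intros LIMSEQ_Suc lim_1_over_n)
    \<comment> \<open>The filter \<open>at x\<close> excludes \<open>x\<close> itself, which is
      harmless because every step \<open>?h n\<close> is nonzero.\<close>
    then have "filterlim (\<lambda>n. x + ?h n) (at x) sequentially"
      by (auto simp: filterlim_at)
    from filterlim_compose[OF conjunct2[OF D[unfolded has_derivative_at2]] this]
    have "(\<lambda>n. (1 / norm (?h n)) *\<^sub>R (f (x + ?h n) - (f x + ?D (?h n)))) \<longlonglongrightarrow> 0"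
      by simp
    \<comment> \<open>The step has norm \<open>1 / real (Suc n)\<close> and \<open>?D\<close> is
      linear, so the Frechet remainder is exactly the difference quotient minus the partial
      derivative.\<close>
    also have "(\<lambda>n. (1 / norm (?h n)) *\<^sub>R (f (x + ?h n) - (f x + ?D (?h n)))) = (\<lambda>n. ?q n x - ?D (axis i 1))"
      by (simp add: scaleR scaleR_diff_right scaleR_add_right fun_eq_iff del: of_nat_Suc)
    finally show ?thesis
      by (simp add: grad_def LIM_zero_iff)
  qed
  then have "(\<lambda>x. grad f x $ i) = (\<lambda>x. if x = 0 then grad f 0 $ i else lim (\<lambda>n. ?q n x))"
    by (intro ext) (simp add: limI[symmetric] del: of_nat_Suc)
  also have "\<dots> \<in> borel_measurable borel" by measurable
  finally show ?thesis .
qed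

section \<open>Joint measurability of the two forward operators\<close>

lemma K_point_measurable:
  assumes "0 < k"
  shows "(\<lambda>(p, y). K_point k p y) \<in> borel_measurable (borel \<Otimes>\<^sub>M borel)"
proof -
  \<comment> \<open>All components are read as continuous maps on the product space with its Borel
    sets; \<open>borel_prod\<close> identifies these with the product sigma-algebra at the
    end.\<close>
  let ?lam = "\<lambda>x::'a point_params \<times> (real^2). fst (fst x)" and ?xi = "\<lambda>x::'a point_params \<times> (real^2). fst (snd (fst x))"
    and ?z = "\<lambda>x::'a point_params \<times> (real^2). snd (snd (fst x))"
  have grad: "(\<lambda>x. grad (Phi k 0) x $ i) \<in> borel_measurable borel" for i
    by (intro grad_measurable Phi_differentiable assms) measurable
  have params: "(\<lambda>x. ?lam x $ j) \<in> borel_measurable borel" "(\<lambda>x. ?xi x $ j $ i) \<in> borel_measurable borel" for j i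
    by (intro borel_measurable_continuous_onI continuous_intros)+
  have "(\<lambda>x. (snd x, ?z x $ j)) \<in> borel \<rightarrow>\<^sub>M borel" "(\<lambda>x. ?z x $ j - snd x) \<in> borel \<rightarrow>\<^sub>M borel" for j
    by (intro borel_measurable_continuous_onI continuous_intros)+
  then have Phi: "(\<lambda>x. Phi k (snd x) (?z x $ j)) \<in> borel_measurable borel"
    and dPhi: "(\<lambda>x. grad (Phi k 0) (?z x $ j - snd x) $ i) \<in> borel_measurable borel" for j i
    using measurable_compose[OF _ Phi_measurable[of k, unfolded borel_prod]] measurable_compose[OF _ grad]
    by fastforce+
  have "(\<lambda>x. \<Sum>j\<in>UNIV. of_real (?lam x $ j) * Phi k (snd x) (?z x $ j)
      - (\<Sum>i\<in>UNIV. of_real (?xi x $ j $ i) * grad (Phi k 0) (?z x $ j - snd x) $ i)) \<in> borel_measurable borel"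
    by (intro borel_measurable_sum borel_measurable_diff borel_measurable_times
        measurable_compose[OF _ borel_measurable_of_real] params Phi dPhi)
  also have "(\<lambda>x. \<Sum>j\<in>UNIV. of_real (?lam x $ j) * Phi k (snd x) (?z x $ j)
      - (\<Sum>i\<in>UNIV. of_real (?xi x $ j $ i) * grad (Phi k 0) (?z x $ j - snd x) $ i))
      = (\<lambda>(p, y). K_point k p y)"
    by (rule ext) (simp only: K_point_def case_prod_beta' grad_Phi[of k "snd x" for x])
  finally show ?thesis by (simp only: borel_prod)
qed

text \<open>An integral over the sigma-finite measure \<open>lborel\<close> depends measurably on
  the parameters of a jointly measurable integrand.\<close>

lemma K_ext_measurable:
  assumes [measurable]: "V \<in> sets borel"
  shows "(\<lambda>(p, y). K_ext V k p y) \<in> borel_measurable (borel \<Otimes>\<^sub>M borel)"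
proof -
  have "(\<lambda>(p, x). F_ext p x) \<in> borel_measurable borel"
    unfolding F_ext_def case_prod_beta'
    by (intro borel_measurable_continuous_onI continuous_intros)
  then have [measurable]: "(\<lambda>(p, x). F_ext p x) \<in> borel_measurable (borel \<Otimes>\<^sub>M borel)"
    by (simp add: borel_prod)
  show ?thesis
    unfolding K_ext_def case_prod_beta' set_lebesgue_integral_def
    by measurable
qed
theorem theorem5:
  fixes V :: "(real^2) set" and g :: "real \<Rightarrow> real^2" and k \<gamma> :: real
  assumes "open V" and "connected V" and "V \<noteq> {}" and "bounded V"
    and "rectifiable_path g" and "path_image g \<inter> closure V = {}"
    and "k > 0" and "\<gamma> > 0"
  shows "(\<forall>\<mu>0 :: 'j::finite point_params measure.
            prob_space \<mu>0 \<and> sets \<mu>0 = sets borel \<and>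
            (AE (lam, xi, z) in \<mu>0. \<forall>j. z $ j \<in> V) \<longrightarrow>
            bayes_well_posed \<mu>0 g (K_point k) \<gamma>) \<and>
         (\<forall>\<mu>0 :: 'j ext_params measure.
            prob_space \<mu>0 \<and> sets \<mu>0 = sets borel \<longrightarrow>
            bayes_well_posed \<mu>0 g (K_ext V k) \<gamma>)"
proof (intro conjI allI impI)
  fix \<mu>0 :: "'j point_params measure"
  assume "prob_space \<mu>0 \<and> sets \<mu>0 = sets borel \<and> (AE (lam, xi, z) in \<mu>0. \<forall>j. z $ j \<in> V)"
  then show "bayes_well_posed \<mu>0 g (K_point k) \<gamma>"
    using assms by (intro bayes_well_posedI K_point_measurable) (auto simp: rectifiable_path_def)
next
  fix \<mu>0 :: "'j ext_params measure"
  assume "prob_space \<mu>0 \<and> sets \<mu>0 = sets borel"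
  then show "bayes_well_posed \<mu>0 g (K_ext V k) \<gamma>"
    using assms by (intro bayes_well_posedI K_ext_measurable) (auto simp: rectifiable_path_def)
qed

end
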